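(* If a graph $G_1$ admits an $S^1$-flow, then every graph $G=\mathcal{B}\uplus G_1$ obtained from $G_1$ by a bull-growth operation also admits an $S^1$-flow.
   Context: All graphs are finite and loopless; parallel edges are allowed. An $S^1$-flow of $G$ is a pair $(D,f)$ where $D$ is an orientation of $G$ and $f:E(G)\to S^1=\{\mathbf{x}\in\mathbb{R}^2:\|\mathbf{x}\|=1\}$ satisfies, at every vertex $v$, that the sum of $f(e)$ over edges $e$ directed out of $v$ equals the sum of $f(e)$ over edges directed into $v$. Bull-reduction and bull-growth: let $u$ and $v$ be adjacent vertices of degree $3$ in a graph $G$, each having three distinct neighbors, with $N_G(u)=\{v,w,a\}$ and $N_G(v)=\{u,w,b\}$; the vertices $a$ and $b$ may coincide. Define $G_1=G-u-v+ab$ if $a\ne b$ (a new edge $ab$ is added, possibly parallel to existing edges), and $G_1=G-u-v$ if $a=b$. Then $G_1$ is called the bull-reduction of $G$, $G$ is called a bull-growth of $G_1$, and one writes $G=\mathcal{B}\uplus G_1$. *)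

theory Defs
  imports "HOL-Analysis.Analysis" "Graph_Theory.Digraph"
begin

(* Undirected multigraphs: every edge is a named object with a set of two end vertices,
   so parallel edges are different names with the same ends. The value of mends outside
   medges carries no meaning. *)

record ('a, 'b) mgraph =
  mverts :: "'a set"
  medges :: "'b set"
  mends  :: "'b \<Rightarrow> 'a set"

locale loopless_mgraph =
  fixes G :: "('a, 'b) mgraph"
  assumes finite_mverts: "finite (mverts G)"
    and finite_medges: "finite (medges G)"
    and mends_subset: "e \<in> medges G \<Longrightarrow> mends G e \<subseteq> mverts G"
    and card_mends: "e \<in> medges G \<Longrightarrow> card (mends G e) = 2"

definition inc_edges :: "('a, 'b) mgraph \<Rightarrow> 'a \<Rightarrow> 'b set" where
  "inc_edges G v = {e \<in> medges G. v \<in> mends G e}"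

(* correct as a degree because there are no loops *)
definition mdegree :: "('a, 'b) mgraph \<Rightarrow> 'a \<Rightarrow> nat" where
  "mdegree G v = card (inc_edges G v)"

definition madjacent :: "('a, 'b) mgraph \<Rightarrow> 'a \<Rightarrow> 'a \<Rightarrow> bool" where
  "madjacent G u v \<longleftrightarrow> (\<exists>e \<in> medges G. mends G e = {u, v})"

definition nbrs :: "('a, 'b) mgraph \<Rightarrow> 'a \<Rightarrow> 'a set" where
  "nbrs G v = {x \<in> mverts G. madjacent G v x}"

definition del_mverts :: "('a, 'b) mgraph \<Rightarrow> 'a set \<Rightarrow> ('a, 'b) mgraph" where
  "del_mverts G X =
     \<lparr>mverts = mverts G - X, medges = {e \<in> medges G. mends G e \<inter> X = {}}, mends = mends G\<rparr>"

definition add_medge :: "('a, 'b) mgraph \<Rightarrow> 'b \<Rightarrow> 'a \<Rightarrow> 'a \<Rightarrow> ('a, 'b) mgraph" where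
  "add_medge G e a b =
     \<lparr>mverts = mverts G, medges = insert e (medges G), mends = (mends G)(e := {a, b})\<rparr>"

(* equality of graphs, disregarding the meaningless values of mends *)
definition same_mgraph :: "('a, 'b) mgraph \<Rightarrow> ('a, 'b) mgraph \<Rightarrow> bool" where
  "same_mgraph G H \<longleftrightarrow>
     mverts G = mverts H \<and> medges G = medges H \<and> (\<forall>e \<in> medges G. mends G e = mends H e)"

(* The name e of the new edge ab is arbitrary, as long as no edge of G - u - v has it. *)
definition bull_reduction :: "('a, 'b) mgraph \<Rightarrow> ('a, 'b) mgraph \<Rightarrow> bool" where
  "bull_reduction G G1 \<longleftrightarrow>
     (\<exists>u v w a b.
        u \<in> mverts G \<and> v \<in> mverts G \<and> madjacent G u v \<and>
        mdegree G u = 3 \<and> mdegree G v = 3 \<and>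
        nbrs G u = {v, w, a} \<and> card (nbrs G u) = 3 \<and>
        nbrs G v = {u, w, b} \<and> card (nbrs G v) = 3 \<and>
        (if a = b then same_mgraph G1 (del_mverts G {u, v})
         else \<exists>e. e \<notin> medges (del_mverts G {u, v}) \<and>
                  same_mgraph G1 (add_medge (del_mverts G {u, v}) e a b)))"

abbreviation bull_growth :: "('a, 'b) mgraph \<Rightarrow> ('a, 'b) mgraph \<Rightarrow> bool" where
  "bull_growth G1 G \<equiv> bull_reduction G G1"

definition orientation_of :: "('a, 'b) pre_digraph \<Rightarrow> ('a, 'b) mgraph \<Rightarrow> bool" where
  "orientation_of D G \<longleftrightarrow>
     verts D = mverts G \<and> arcs D = medges G \<and>
     (\<forall>e \<in> medges G. {tail D e, head D e} = mends G e)"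

definition S1_flow ::
  "('a, 'b) mgraph \<Rightarrow> ('a, 'b) pre_digraph \<Rightarrow> ('b \<Rightarrow> real ^ 2) \<Rightarrow> bool" where
  "S1_flow G D f \<longleftrightarrow>
     orientation_of D G \<and>
     (\<forall>e \<in> medges G. f e \<in> sphere 0 1) \<and>
     (\<forall>v \<in> mverts G. (\<Sum>e \<in> out_arcs D v. f e) = (\<Sum>e \<in> in_arcs D v. f e))"

definition admits_S1_flow :: "('a, 'b) mgraph \<Rightarrow> bool" where
  "admits_S1_flow G \<longleftrightarrow> (\<exists>D f. S1_flow G D f)"

end

theory Submission
  imports Defs
begin

text \<open>
  Let \<open>x\<close> be the vector that the flow of \<open>G1\<close> sends from \<open>a\<close> to \<open>b\<close> along the edge \<open>ab\<close>.
  In \<open>G\<close> the same vector travels along \<open>a \<rightarrow> u\<close>, crosses the triangle \<open>uvw\<close>, and leaves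
  along \<open>v \<rightarrow> b\<close>. Inside the triangle it splits as \<open>x = p + q\<close>, with \<open>p\<close> on \<open>u \<rightarrow> v\<close> and
  \<open>q\<close> on \<open>u \<rightarrow> w \<rightarrow> v\<close>. In the plane \<open>p\<close> and \<open>q\<close> can be taken to be unit vectors, namely
  \<open>x\<close> rotated by 60 degrees either way (\<open>unit_vector_split\<close>). Whatever else happens at \<open>w\<close>
  is not disturbed, since \<open>q\<close> enters and leaves. If \<open>a = b\<close>, the detour is a closed
  circulation through \<open>a\<close>, and any unit vector serves as \<open>x\<close>.

  Both cases are the same computation once the flow on \<open>G - u - v\<close> is described by the
  demand it leaves open: \<open>x\<close> has still to go out of \<open>a\<close> and into \<open>b\<close>, which is no demand at
  all when \<open>a = b\<close> (\<open>reduced_flow_demand\<close>). The degree conditions enter through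
  \<open>simple_cubic_vertex\<close>: there is exactly one edge to each neighbour of \<open>u\<close> and of \<open>v\<close>,
  hence exactly five edges to be given values.
\<close>

section \<open>Splitting a unit vector\<close>

lemma unit_vector_split:
  fixes x :: "real ^ 2"
  assumes "norm x = 1"
  obtains p q :: "real ^ 2" where "norm p = 1" "norm q = 1" "p + q = x"
proof
  \<comment> \<open>The rotations of \<open>x\<close> by 60 degrees in either direction, in terms of a vector \<open>y\<close>
    orthogonal to \<open>x\<close>.\<close>
  define y :: "real ^ 2" where "y = vector [- x $ 2, x $ 1]"
  define s where "s = sqrt 3 / 2"
  have s: "s * s = 3 / 4"
    by (simp add: s_def)
  have xx: "x \<bullet> x = 1"
    using assms by (simp add: norm_eq_1)
  have yy: "y \<bullet> y = 1"
    using xx by (simp add: y_def inner_vec_def sum_2)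
  have xy: "x \<bullet> y = 0" "y \<bullet> x = 0"
    by (simp_all add: y_def inner_vec_def sum_2)
  show "norm ((1 / 2) *\<^sub>R x + s *\<^sub>R y) = 1"
    by (simp add: norm_eq_1 inner_add_left inner_add_right xx yy xy s)
  show "norm ((1 / 2) *\<^sub>R x - s *\<^sub>R y) = 1"
    by (simp add: norm_eq_1 inner_diff_left inner_diff_right xx yy xy s)
  show "((1 / 2) *\<^sub>R x + s *\<^sub>R y) + ((1 / 2) *\<^sub>R x - s *\<^sub>R y) = x"
    by (simp flip: scaleR_add_left)
qed

section \<open>Conservation as a vanishing sum over all edges\<close>

text \<open>Both sides of the conservation law are sums over sets that change with the
  orientation. With signed contributions the law becomes one sum over a fixed edge set, from
  which single edges can be split off.\<close>

definition net_out :: "('b \<Rightarrow> 'a) \<Rightarrow> ('b \<Rightarrow> 'a) \<Rightarrow> ('b \<Rightarrow> 'c::ab_group_add) \<Rightarrow> 'a \<Rightarrow> 'b \<Rightarrow> 'c" where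
  "net_out t h f z e = (if t e = z then f e else 0) - (if h e = z then f e else 0)"

lemma sum_net_out:
  assumes "finite (arcs D)"
  shows "(\<Sum>e \<in> arcs D. net_out (tail D) (head D) f z e) =
         (\<Sum>e \<in> out_arcs D z. f e) - (\<Sum>e \<in> in_arcs D z. f e)"
  using assms
  by (simp add: net_out_def sum_subtractf out_arcs_def in_arcs_def sum.inter_filter)

lemma admits_S1_flow_iff:
  assumes "finite (medges G)"
  shows "admits_S1_flow G \<longleftrightarrow>
    (\<exists>t h f. (\<forall>e \<in> medges G. {t e, h e} = mends G e \<and> norm (f e :: real ^ 2) = 1) \<and>
             (\<forall>z \<in> mverts G. (\<Sum>e \<in> medges G. net_out t h f z e) = 0))"
    (is "_ \<longleftrightarrow> ?R")
proof
  assume "admits_S1_flow G"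
  then obtain D f where D: "S1_flow G D f"
    by (auto simp: admits_S1_flow_def)
  then have "arcs D = medges G"
    by (simp add: S1_flow_def orientation_of_def)
  with D sum_net_out[of D f] assms show ?R
    by (intro exI[of _ "tail D"] exI[of _ "head D"] exI[of _ f])
       (auto simp: S1_flow_def orientation_of_def)
next
  assume ?R
  then obtain t h f where
    R: "\<forall>e \<in> medges G. {t e, h e} = mends G e \<and> norm (f e :: real ^ 2) = 1"
       "\<forall>z \<in> mverts G. (\<Sum>e \<in> medges G. net_out t h f z e) = 0"
    by blast
  let ?D = "\<lparr>verts = mverts G, arcs = medges G, tail = t, head = h\<rparr>"
  have "S1_flow G ?D f"
    using R sum_net_out[of ?D f] assms by (auto simp: S1_flow_def orientation_of_def)
  then show "admits_S1_flow G"
    by (auto simp: admits_S1_flow_def)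
qed

section \<open>The edges around the triangle\<close>

text \<open>Three distinct neighbours already use up three edges, so degree 3 leaves no room for
  parallel ones.\<close>

lemma simple_cubic_vertex:
  assumes deg: "mdegree G u = 3" and nb: "nbrs G u = {x, y, z}" and card: "card (nbrs G u) = 3"
  obtains ex ey ez where "inc_edges G u = {ex, ey, ez}" "distinct [ex, ey, ez]"
    "mends G ex = {u, x}" "mends G ey = {u, y}" "mends G ez = {u, z}"
proof -
  have dist: "x \<noteq> y" "x \<noteq> z" "y \<noteq> z"
    using card nb by (auto simp: card_insert_if split: if_splits)
  have "madjacent G u x" "madjacent G u y" "madjacent G u z"
    using nb by (auto simp: nbrs_def)
  then obtain ex ey ez where e: "ex \<in> medges G" "ey \<in> medges G" "ez \<in> medges G"
    "mends G ex = {u, x}" "mends G ey = {u, y}" "mends G ez = {u, z}"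
    by (auto simp: madjacent_def)
  have d: "distinct [ex, ey, ez]"
    using e dist by (auto simp: doubleton_eq_iff)
  have fin: "finite (inc_edges G u)"
    using deg by (auto simp: mdegree_def intro: card_ge_0_finite)
  have "{ex, ey, ez} = inc_edges G u"
    using deg d e by (intro card_subset_eq[OF fin]) (auto simp: mdegree_def inc_edges_def)
  from that[OF this[symmetric] d e(4,5,6)] show thesis .
qed

section \<open>Transporting the flow\<close>

text \<open>Here \<open>H\<close> stands for \<open>G - u - v\<close>. Removing the edge \<open>ab\<close> from the flow of the reduced
  graph leaves at \<open>a\<close> an inflow and at \<open>b\<close> an outflow of \<open>x\<close> too much; these two defects
  are what the triangle later has to connect, and they cancel when \<open>a = b\<close>.
  The case distinction on \<open>a = b\<close> is confined to this lemma.\<close>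

lemma reduced_flow_demand:
  fixes G G1 :: "('a, 'b) mgraph"
  assumes fin: "finite (medges G1)" and flow: "admits_S1_flow G1"
    and red: "if a = b then same_mgraph G1 H
              else \<exists>e. e \<notin> medges H \<and> same_mgraph G1 (add_medge H e a b)"
  obtains t h and f :: "'b \<Rightarrow> real ^ 2" and x where
    "\<And>e. e \<in> medges H \<Longrightarrow> {t e, h e} = mends H e"
    "\<And>e. e \<in> medges H \<Longrightarrow> norm (f e) = 1"
    "norm x = 1"
    "\<And>z. z \<in> mverts H \<Longrightarrow>
       (\<Sum>e \<in> medges H. net_out t h f z e) = (if z = b then x else 0) - (if z = a then x else 0)"
proof -
  obtain t h and f :: "'b \<Rightarrow> real ^ 2" where
    F: "\<And>e. e \<in> medges G1 \<Longrightarrow> {t e, h e} = mends G1 e \<and> norm (f e) = 1"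
       "\<And>z. z \<in> mverts G1 \<Longrightarrow> (\<Sum>e \<in> medges G1. net_out t h f z e) = 0"
    using flow unfolding admits_S1_flow_iff[OF fin] by blast
  show thesis
  proof (cases "a = b")
    case True
    then have same: "same_mgraph G1 H"
      using red by simp
    obtain x :: "real ^ 2" where "norm x = 1"
      by (metis norm_axis_1)
    then show thesis
      using that[of t h f x] F same True by (auto simp: same_mgraph_def)
  next
    case False
    then obtain e where e: "e \<notin> medges H" and same: "same_mgraph G1 (add_medge H e a b)"
      using red by auto
    have V: "mverts G1 = mverts H" and E: "medges G1 = insert e (medges H)"
      using same by (auto simp: same_mgraph_def add_medge_def)
    have ends: "mends G1 e = {a, b}" "\<And>e'. e' \<in> medges H \<Longrightarrow> mends G1 e' = mends H e'"
      using same e by (auto simp: same_mgraph_def add_medge_def)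
    have ab: "t e = a \<and> h e = b \<or> t e = b \<and> h e = a"
      using F(1)[of e] ends E by (auto simp: doubleton_eq_iff)
    \<comment> \<open>The value of the new edge read in the direction from \<open>a\<close> to \<open>b\<close>.\<close>
    define x where "x = (if t e = a then f e else - f e)"
    have sum: "net_out t h f z e + (\<Sum>e' \<in> medges H. net_out t h f z e') = 0"
      if "z \<in> mverts H" for z
      using F(2)[of z] that e fin by (simp add: V E)
    show thesis
    proof (rule that[of t h f x])
      show "norm x = 1"
        using F(1)[of e] E by (simp add: x_def)
      show "(\<Sum>e \<in> medges H. net_out t h f z e) =
              (if z = b then x else 0) - (if z = a then x else 0)"
        if "z \<in> mverts H" for z
      proof -
        have "(\<Sum>e \<in> medges H. net_out t h f z e) = - net_out t h f z e"
          using sum[OF that] by (simp add: eq_neg_iff_add_eq_0 add.commute)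
        also have "\<dots> = (if z = b then x else 0) - (if z = a then x else 0)"
          using ab False by (auto simp: net_out_def x_def)
        finally show ?thesis .
      qed
    qed (use F E ends in auto)
  qed
qed

theorem theorem3p10:
  fixes G G1 :: "('a, 'b) mgraph"
  assumes "loopless_mgraph G1"
    and "admits_S1_flow G1"
    and "loopless_mgraph G"
    and "bull_growth G1 G"
  shows "admits_S1_flow G"
proof -
  interpret G: loopless_mgraph G
    by fact
  have fin: "finite (medges G)" and fin1: "finite (medges G1)"
    using assms(1) by (auto simp: G.finite_medges loopless_mgraph.finite_medges)
  obtain u v w a b where
    deg: "mdegree G u = 3" "mdegree G v = 3" and
    nu: "nbrs G u = {v, w, a}" "card (nbrs G u) = 3" and
    nv: "nbrs G v = {u, w, b}" "card (nbrs G v) = 3" and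
    red: "if a = b then same_mgraph G1 (del_mverts G {u, v})
          else \<exists>e. e \<notin> medges (del_mverts G {u, v}) \<and>
                   same_mgraph G1 (add_medge (del_mverts G {u, v}) e a b)"
    using assms(4) unfolding bull_reduction_def by blast
  define H where "H = del_mverts G {u, v}"
  have VH: "mverts H = mverts G - {u, v}"
    and EH: "medges H = {e \<in> medges G. u \<notin> mends G e \<and> v \<notin> mends G e}"
    and endsH: "mends H = mends G"
    by (auto simp: H_def del_mverts_def)

  obtain uv uw ua where iu: "inc_edges G u = {uv, uw, ua}" and du: "distinct [uv, uw, ua]"
    and eu: "mends G uv = {u, v}" "mends G uw = {u, w}" "mends G ua = {u, a}"
    using simple_cubic_vertex[OF deg(1) nu] by metis
  obtain vu vw vb where iv: "inc_edges G v = {vu, vw, vb}" and dv: "distinct [vu, vw, vb]"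
    and ev: "mends G vu = {v, u}" "mends G vw = {v, w}" "mends G vb = {v, b}"
    using simple_cubic_vertex[OF deg(2) nv] by metis
  have ne: "v \<noteq> w" "v \<noteq> a" "w \<noteq> a" "u \<noteq> w" "u \<noteq> b" "w \<noteq> b"
    using nu nv by (auto simp: card_insert_if split: if_splits)
  have in_G: "uv \<in> medges G" "uw \<in> medges G" "ua \<in> medges G" "vw \<in> medges G" "vb \<in> medges G"
    using iu iv unfolding inc_edges_def by blast+
  have ne2: "u \<noteq> v" "u \<noteq> a" "v \<noteq> b"
    using G.card_mends[OF in_G(1)] G.card_mends[OF in_G(3)] G.card_mends[OF in_G(5)] eu ev
    by auto
  have "vu \<in> inc_edges G u"
    using iv ev by (auto simp: inc_edges_def)
  then have "vu = uv"
    using iu eu ev ne ne2 by (auto simp: doubleton_eq_iff)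
  then have dist: "distinct [uv, uw, ua, vw, vb]"
    using du dv eu ev ne ne2 by (auto simp: doubleton_eq_iff)
  have EG: "medges G = medges H \<union> {uv, uw, ua, vw, vb}"
    using iu iv \<open>vu = uv\<close> in_G unfolding EH inc_edges_def by blast
  have notH: "uv \<notin> medges H" "uw \<notin> medges H" "ua \<notin> medges H" "vw \<notin> medges H" "vb \<notin> medges H"
    using eu ev by (auto simp: EH)

  obtain t h and f :: "'b \<Rightarrow> real ^ 2" and x where
    F: "\<And>e. e \<in> medges H \<Longrightarrow> {t e, h e} = mends H e"
       "\<And>e. e \<in> medges H \<Longrightarrow> norm (f e) = 1"
    and x: "norm x = 1"
    and demand: "\<And>z. z \<in> mverts H \<Longrightarrow>
       (\<Sum>e \<in> medges H. net_out t h f z e) = (if z = b then x else 0) - (if z = a then x else 0)"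
    using reduced_flow_demand[OF fin1 assms(2) red[folded H_def]] by metis
  obtain p q where pq: "norm p = 1" "norm q = 1" "p + q = x"
    using unit_vector_split[OF x] .

  \<comment> \<open>Route \<open>x\<close> along \<open>a \<rightarrow> u\<close> and \<open>v \<rightarrow> b\<close>, with \<open>p\<close> on \<open>u \<rightarrow> v\<close> and \<open>q\<close> on \<open>u \<rightarrow> w \<rightarrow> v\<close>.\<close>
  define T where "T = t(uv := u, uw := u, ua := a, vw := w, vb := v)"
  define K where "K = h(uv := v, uw := w, ua := u, vw := v, vb := b)"
  define g where "g = f(uv := p, uw := q, ua := x, vw := q, vb := x)"
  have old: "T e = t e" "K e = h e" "g e = f e" if "e \<in> medges H" for e
    using that notH by (auto simp: T_def K_def g_def)
  have new: "T uv = u" "T uw = u" "T ua = a" "T vw = w" "T vb = v"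
    "K uv = v" "K uw = w" "K ua = u" "K vw = v" "K vb = b"
    "g uv = p" "g uw = q" "g ua = x" "g vw = q" "g vb = x"
    using dist by (auto simp: T_def K_def g_def)

  have "{T e, K e} = mends G e \<and> norm (g e) = 1" if "e \<in> medges G" for e
  proof (cases "e \<in> medges H")
    case True
    then show ?thesis
      using F endsH by (simp add: old)
  next
    case False
    then have "e \<in> {uv, uw, ua, vw, vb}"
      using that EG by blast
    then show ?thesis
      using new eu ev pq x by (auto simp: insert_commute)
  qed
  moreover have "(\<Sum>e \<in> medges G. net_out T K g z e) = 0" if z: "z \<in> mverts G" for z
  proof -
    have "(\<Sum>e \<in> medges G. net_out T K g z e) =
          (\<Sum>e \<in> medges H. net_out T K g z e) + (\<Sum>e \<in> {uv, uw, ua, vw, vb}. net_out T K g z e)"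
      unfolding EG using fin notH by (intro sum.union_disjoint) (auto simp: EG)
    also have "(\<Sum>e \<in> medges H. net_out T K g z e) = (\<Sum>e \<in> medges H. net_out t h f z e)"
      by (intro sum.cong) (auto simp: net_out_def old)
    also have "\<dots> = (if z = b then x else 0) - (if z = a then x else 0)"
    proof (cases "z \<in> mverts H")
      case False
      \<comment> \<open>No edge of \<open>H\<close> meets \<open>u\<close> or \<open>v\<close>, and neither of the two is \<open>a\<close> or \<open>b\<close>.\<close>
      then have "z = u \<or> z = v"
        using z VH by auto
      moreover have "t e \<noteq> u \<and> t e \<noteq> v \<and> h e \<noteq> u \<and> h e \<noteq> v" if "e \<in> medges H" for e
        using that F(1)[OF that] by (auto simp: EH endsH)
      ultimately have "(\<Sum>e \<in> medges H. net_out t h f z e) = 0"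
        by (intro sum.neutral) (auto simp: net_out_def)
      then show ?thesis
        using \<open>z = u \<or> z = v\<close> ne ne2 by auto
    qed (rule demand)
    also have "(\<Sum>e \<in> {uv, uw, ua, vw, vb}. net_out T K g z e) =
        net_out T K g z uv + net_out T K g z uw + net_out T K g z ua
        + net_out T K g z vw + net_out T K g z vb"
      using dist by (simp add: add.assoc)
    also have "(if z = b then x else 0) - (if z = a then x else 0) + \<dots> = 0"
      using ne ne2 pq(3)[symmetric] by (simp add: net_out_def new)
    finally show ?thesis .
  qed
  ultimately show ?thesis
    unfolding admits_S1_flow_iff[OF fin] by blast
qed

end
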